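(* Let $n$ and $m$ be positive integers. Then $$\zeta_{\mathbb{Z}/n\mathbb{Z}}\left(-\frac12-m\right)=2^{2m+1}\sum_{k=1}^{n-1}\sin^{2m+1}\left(\frac{\pi k}{n}\right)=2\sum_{j=0}^{m}(-1)^{m-j}\binom{2m+1}{j}\cot\left(\frac{2m+1-2j}{2n}\pi\right).$$
   Context: For a positive integer $n$, the spectral zeta function of $\mathbb{Z}/n\mathbb{Z}$ is the function of $s\in\mathbb{C}$ $$\zeta_{\mathbb{Z}/n\mathbb{Z}}(s)=\frac{1}{4^{s}}\sum_{k=1}^{n-1}\frac{1}{\sin^{2s}(\pi k/n)},$$ where the powers are those of the positive real numbers $\sin(\pi k/n)$, $1\le k\le n-1$ (the sum is empty, hence $0$, when $n=1$). *)

theory Defs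
  imports "HOL-Analysis.Complex_Transcendental"
begin

text \<open>For \<open>1 \<le> k \<le> n - 1\<close> the base \<open>sin (pi * k / n)\<close> is a positive real, so the complex
  \<open>powr\<close> is the power of a positive real number, \<open>exp (2 * s * ln (sin (pi * k / n)))\<close>.\<close>

definition spectral_zeta_cyclic :: "nat \<Rightarrow> complex \<Rightarrow> complex" where
  "spectral_zeta_cyclic n s =
     1 / (4 powr s) *
     (\<Sum>k = 1..n - 1. 1 / (complex_of_real (sin (pi * real k / real n)) powr (2 * s)))"

end

theory Submission
  imports Defs
begin

text \<open>Expanding \<open>(2 * \<i> * sin x) ^ (2 * m + 1) = (cis x - cis (- x)) ^ (2 * m + 1)\<close> by the binomial
  theorem linearises the odd power of the sine into sines of odd multiples of \<open>x\<close>; summing each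
  of these over \<open>x = pi * k / n\<close> telescopes to a cotangent.\<close>

lemma sin_odd_power_expansion:
  fixes x :: real
  shows "2 ^ (2 * m) * sin x ^ (2 * m + 1) =
    (\<Sum>j = 0..m. (- 1) ^ (m - j) * real ((2 * m + 1) choose j) * sin ((2 * real m + 1 - 2 * real j) * x))"
proof -
  define N where "N = 2 * m + 1"
  define f where "f j = (- 1) ^ j * real (N choose j) * sin ((real N - 2 * real j) * x)" for j
  have summand: "of_nat (N choose j) * (- cis (- x)) ^ j * cis x ^ (N - j) =
      of_real ((- 1) ^ j * real (N choose j)) * cis ((real N - 2 * real j) * x)" if "j \<le> N" for j
  proof -
    have "(- cis (- x)) ^ j * cis x ^ (N - j) = (- 1) ^ j * (cis (- x) ^ j * cis x ^ (N - j))"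
      by (subst power_minus) simp
    also have "cis (- x) ^ j * cis x ^ (N - j) = cis ((real N - 2 * real j) * x)"
      using that by (simp add: Complex.DeMoivre cis_mult of_nat_diff algebra_simps)
    finally show ?thesis by (simp add: mult.assoc mult.left_commute)
  qed
  \<comment> \<open>The negated term stands first so that in \<open>binomial_ring\<close> the index
    \<open>j\<close> counts the factors \<open>- cis (- x)\<close>, as in
    \<open>summand\<close>.\<close>
  have "- cis (- x) + cis x = of_real (2 * sin x) * \<i>"
    by (simp add: complex_eq_iff)
  then have "(of_real (2 * sin x) * \<i>) ^ N = (- cis (- x) + cis x) ^ N" by simp
  also have "\<dots> = (\<Sum>j\<le>N. of_real ((- 1) ^ j * real (N choose j)) * cis ((real N - 2 * real j) * x))"
    unfolding binomial_ring by (intro sum.cong HOL.refl summand) simp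
  finally have "Im ((of_real (2 * sin x) * \<i>) ^ N) = (\<Sum>j\<le>N. f j)"
    by (simp add: f_def del: of_real_mult)
  \<comment> \<open>Since \<open>N\<close> is odd, the left-hand power is purely imaginary, so
    comparing imaginary parts loses nothing and turns each \<open>cis\<close> into a sine.\<close>
  moreover have "(of_real (2 * sin x) * \<i>) ^ N = of_real ((2 * sin x) ^ N * (- 1) ^ m) * \<i>"
  proof -
    have "\<i> ^ N = of_real ((- 1) ^ m) * \<i>"
      by (simp add: N_def power_mult)
    then show ?thesis by (simp only: power_mult_distrib of_real_mult of_real_power mult.assoc)
  qed
  ultimately have full: "(2 * sin x) ^ N * (- 1) ^ m = (\<Sum>j\<le>N. f j)"
    by (simp del: of_real_mult)
  \<comment> \<open>Under \<open>j\<close> to \<open>N - j\<close> the sign and the sine both change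
    sign, so \<open>f\<close> is unchanged. As \<open>N\<close> is odd, this reflection has no fixed
    index and swaps \<open>0..m\<close> with \<open>m + 1..N\<close>; the full sum is twice its
    lower half.\<close>
  have refl: "f (N - j) = f j" if "j \<le> m" for j
  proof -
    have "(real N - 2 * real (N - j)) * x = - ((real N - 2 * real j) * x)"
      using that by (simp add: N_def of_nat_diff algebra_simps)
    moreover have "(- 1 :: real) ^ (N - j) = - ((- 1) ^ j)"
      using that by (simp add: N_def minus_one_power_iff)
    moreover have "N choose (N - j) = N choose j"
      using that binomial_symmetric[of j N] by (simp add: N_def)
    ultimately show ?thesis by (simp add: f_def)
  qed
  have "(\<Sum>j\<le>N. f j) = (\<Sum>j\<le>m. f j) + (\<Sum>j = Suc m..N. f j)"
    by (subst sum.union_disjoint[symmetric]) (auto intro!: arg_cong[where f = "sum f"] simp: N_def simp del: sum.atMost_Suc)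
  also have "(\<Sum>j = Suc m..N. f j) = (\<Sum>j\<le>m. f (N - j))"
    by (rule sum.reindex_bij_witness[of _ "\<lambda>j. N - j" "\<lambda>j. N - j"]) (auto simp: N_def)
  finally have "(2 * sin x) ^ N * (- 1) ^ m = 2 * (\<Sum>j\<le>m. f j)"
    using full refl by simp
  then have "2 ^ (2 * m) * sin x ^ N * (- 1) ^ m = (\<Sum>j\<le>m. f j)"
    by (simp add: N_def power_mult_distrib ac_simps)
  \<comment> \<open>Multiplying by \<open>(- 1) ^ m\<close> cancels the sign on the left and turns
    \<open>(- 1) ^ j\<close> into \<open>(- 1) ^ (m - j)\<close> on the right.\<close>
  then have "2 ^ (2 * m) * sin x ^ N * ((- 1) ^ m * (- 1) ^ m) = (\<Sum>j\<le>m. (- 1) ^ m * f j)"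
    by (simp only: sum_distrib_left[symmetric]) (metis mult.assoc mult.commute)
  moreover have "(- 1) ^ m * f j =
      (- 1) ^ (m - j) * real (N choose j) * sin ((2 * real m + 1 - 2 * real j) * x)" if "j \<le> m" for j
  proof -
    have "(- 1 :: real) ^ m * (- 1) ^ j = (- 1) ^ (m - j)"
      using that by (simp add: minus_one_power_iff)
    then show ?thesis by (simp add: f_def N_def algebra_simps)
  qed
  ultimately show ?thesis
    by (simp add: N_def atMost_atLeast0 flip: power_mult_distrib)
qed

text \<open>Each product \<open>2 * sin (t / 2) * sin (k * t)\<close> is a difference of cosines at
  the half-integer multiples \<open>k - 1/2\<close> and \<open>k + 1/2\<close> of \<open>t\<close>.
  Keeping the factor on the left avoids any nonvanishing assumption.\<close>

lemma sum_sin_telescope: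
  fixes t :: real
  shows "2 * sin (t / 2) * (\<Sum>k = 1..n. sin (real k * t)) = cos (t / 2) - cos (real n * t + t / 2)"
proof (induction n)
  case (Suc n)
  have "2 * sin (t / 2) * sin (real (Suc n) * t)
      = cos (real n * t + t / 2) - cos (real (Suc n) * t + t / 2)"
    using cos_add[of "real (Suc n) * t" "t / 2"] cos_diff[of "real (Suc n) * t" "t / 2"]
    by (simp add: algebra_simps)
  then show ?case using Suc by (simp add: distrib_left)
qed simp

text \<open>Oddness of \<open>a\<close> enters twice: it keeps \<open>sin (t / 2)\<close> away from
  zero, and it gives \<open>cos (a * pi) = - 1\<close>, so the two boundary cosines of the
  telescoped sum reinforce each other to \<open>2 * cos (t / 2)\<close>.\<close>

lemma sum_sin_odd_multiple:
  fixes n :: nat and a :: int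
  assumes "n > 0" "odd a"
  shows "(\<Sum>k = 1..n - 1. sin (of_int a * (pi * real k / real n))) = cot (of_int a / (2 * real n) * pi)"
proof -
  define t where "t = of_int a * pi / real n"
  have nonzero: "sin (t / 2) \<noteq> 0"
  proof
    assume "sin (t / 2) = 0"
    then obtain i :: int where "t / 2 = of_int i * pi"
      by (auto simp: sin_zero_iff_int2)
    then have "real_of_int a = of_int (2 * i * int n)"
      using \<open>n > 0\<close> by (simp add: t_def field_simps)
    then have "a = 2 * i * int n" by (simp only: of_int_eq_iff)
    with \<open>odd a\<close> show False by simp
  qed
  have "real (n - 1) * t + t / 2 = of_int a * pi - t / 2"
    using \<open>n > 0\<close> by (simp add: t_def of_nat_diff field_simps)
  then have "cos (real (n - 1) * t + t / 2) = cos (of_int a * pi - t / 2)" by (rule arg_cong)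
  also have "\<dots> = - cos (t / 2)"
  proof -
    have "cos (of_int a * pi) = (- 1 :: real)" "sin (of_int a * pi) = (0 :: real)"
      using \<open>odd a\<close> cos_int_times_real[of a] by (auto simp: cos_zero_iff_int2 sin_zero_iff_int2 mult.commute)
    then show ?thesis by (simp add: cos_diff)
  qed
  finally have "2 * sin (t / 2) * (\<Sum>k = 1..n - 1. sin (real k * t)) = 2 * cos (t / 2)"
    unfolding sum_sin_telescope by simp
  then have "(\<Sum>k = 1..n - 1. sin (real k * t)) = cot (t / 2)"
    using nonzero by (simp add: cot_def field_simps)
  then show ?thesis by (simp add: t_def field_simps)
qed

text \<open>At this argument \<open>- 2 * s\<close> is the natural number \<open>2 * m + 1\<close>,
  so the complex powers of positive reals become ordinary ones.\<close>

lemma spectral_zeta_cyclic_neg_half_integer: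
  "spectral_zeta_cyclic n (- 1 / 2 - of_nat m) =
     complex_of_real (2 ^ (2 * m + 1) * (\<Sum>k = 1..n - 1. sin (pi * real k / real n) ^ (2 * m + 1)))"
proof -
  have inv_powr: "1 / (complex_of_real y powr (2 * (- 1 / 2 - of_nat m))) = of_real (y ^ (2 * m + 1))"
    if "y > 0" for y :: real
  proof -
    have exponent: "2 * (- 1 / 2 - of_nat m :: complex) = - of_nat (2 * m + 1)"
      by (simp add: algebra_simps)
    show ?thesis using that unfolding exponent
      by (subst powr_minus, subst powr_nat') (auto simp: divide_inverse)
  qed
  \<comment> \<open>Writing 4 as the square of 2 lets \<open>inv_powr\<close> at
    \<open>y = 2\<close> treat the prefactor like the summands.\<close>
  have "(4 :: complex) powr (- 1 / 2 - of_nat m) = of_real 2 powr (2 * (- 1 / 2 - of_nat m))"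
  proof -
    have "ln (4 :: real) = 2 * ln 2"
      using ln_realpow[of 2 2] by simp
    then have "Ln (4 :: complex) = 2 * Ln 2"
      using Ln_of_real[of 4] Ln_of_real[of 2] by simp
    then show ?thesis by (simp add: powr_def algebra_simps)
  qed
  then have "1 / ((4 :: complex) powr (- 1 / 2 - of_nat m)) = of_real (2 ^ (2 * m + 1))"
    using inv_powr[of 2] by simp
  moreover have "sin (pi * real k / real n) > 0" if "k \<in> {1..n - 1}" for k
    using that by (intro sin_gt_zero) (auto simp: field_simps)
  ultimately show ?thesis
    unfolding spectral_zeta_cyclic_def of_real_mult of_real_sum
    by (intro arg_cong2[where f = "(*)"] sum.cong HOL.refl inv_powr) auto
qed

theorem proposition5:
  fixes n m :: nat
  assumes "n > 0" and "m > 0"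
  shows "spectral_zeta_cyclic n (- 1 / 2 - of_nat m) =
           complex_of_real (2 ^ (2 * m + 1) *
             (\<Sum>k = 1..n - 1. sin (pi * real k / real n) ^ (2 * m + 1))) \<and>
         2 ^ (2 * m + 1) * (\<Sum>k = 1..n - 1. sin (pi * real k / real n) ^ (2 * m + 1)) =
           2 * (\<Sum>j = 0..m. (- 1) ^ (m - j) * real ((2 * m + 1) choose j) *
             cot ((2 * real m + 1 - 2 * real j) / (2 * real n) * pi))"
proof
  let ?c = "\<lambda>j. (- 1) ^ (m - j) * real ((2 * m + 1) choose j)"
  let ?x = "\<lambda>k. pi * real k / real n"
  \<comment> \<open>The odd multiplier is formed in the integers, where subtraction does not
    truncate, so no bound on \<open>j\<close> is required.\<close>
  have cot: "(\<Sum>k = 1..n - 1. sin ((2 * real m + 1 - 2 * real j) * ?x k))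
      = cot ((2 * real m + 1 - 2 * real j) / (2 * real n) * pi)" for j
    using sum_sin_odd_multiple[OF \<open>n > 0\<close>, of "2 * int m + 1 - 2 * int j"] by simp
  \<comment> \<open>One factor 2 is split off because the expansion of the sine power absorbs
    exactly \<open>2 ^ (2 * m)\<close>.\<close>
  have "2 ^ (2 * m + 1) * (\<Sum>k = 1..n - 1. sin (?x k) ^ (2 * m + 1))
      = 2 * (\<Sum>k = 1..n - 1. 2 ^ (2 * m) * sin (?x k) ^ (2 * m + 1))"
    by (simp add: sum_distrib_left mult.assoc)
  also have "\<dots> = 2 * (\<Sum>j = 0..m. \<Sum>k = 1..n - 1. ?c j * sin ((2 * real m + 1 - 2 * real j) * ?x k))"
    by (subst sum.swap) (simp only: sin_odd_power_expansion)
  also have "\<dots> = 2 * (\<Sum>j = 0..m. ?c j * cot ((2 * real m + 1 - 2 * real j) / (2 * real n) * pi))"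
    by (simp only: sum_distrib_left[symmetric] cot)
  finally show "2 ^ (2 * m + 1) * (\<Sum>k = 1..n - 1. sin (?x k) ^ (2 * m + 1)) =
      2 * (\<Sum>j = 0..m. ?c j * cot ((2 * real m + 1 - 2 * real j) / (2 * real n) * pi))" .
qed (rule spectral_zeta_cyclic_neg_half_integer)

end
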